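(* If $t\to_v^{(m,e)} p$ with $p\in\mathsf{no}_v$, then there exist a context $\Gamma$, a type $\sigma$ and a tight derivation in system $\mathcal{V}$ of $\Gamma\vdash^{(m,e,|p|_v)} t:\sigma$.
   Context: Terms. Fix a countably infinite set of variables. Terms are $t,u,r ::= x \mid \lambda x.t \mid t\,u \mid t[x\backslash u]$, where $t[x\backslash u]$ (explicit substitution) binds $x$ in $t$; terms are taken modulo $\alpha$-conversion and $t\{x:=u\}$ is capture-avoiding meta-level substitution. Values are $v ::= x \mid \lambda x.t$. List contexts are $L ::= \square \mid L[x\backslash t]$; $L\langle t\rangle$ plugs $t$ into the hole. CBV normal forms: $\mathsf{vr}_v ::= x \mid \mathsf{vr}_v[x\backslash \mathsf{ne}_v]$; $\mathsf{ne}_v ::= \mathsf{vr}_v\,\mathsf{no}_v \mid \mathsf{ne}_v\,\mathsf{no}_v \mid \mathsf{ne}_v[x\backslash\mathsf{ne}_v]$; $\mathsf{no}_v ::= \lambda x.t \mid \mathsf{vr}_v \mid \mathsf{ne}_v \mid \mathsf{no}_v[x\backslash\mathsf{ne}_v]$. The $v$-size is $|x|_v = 0$, $|\lambda x.t|_v=0$, $|t\,u|_v = |t|_v+|u|_v+1$, $|t[x\backslash u]|_v = |t|_v+|u|_v$. Reduction. Rule $\mathtt{dB}$: $(L\langle\lambda x.t\rangle)\,u\mapsto L\langle t[x\backslash u]\rangle$; rule $\mathtt{sv}$: $t[x\backslash L\langle v\rangle]\mapsto L\langle t\{x:=v\}\rangle$ for a value $v$. CBV contexts are $V ::= \square \mid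 V\,t \mid t\,V \mid V[x\backslash u] \mid t[x\backslash V]$, and $\to_v$ is the closure of $\mathtt{dB}\cup\mathtt{sv}$ under CBV contexts. $\mathtt{dB}$-steps are multiplicative ($m$-steps), $\mathtt{sv}$-steps exponential ($e$-steps); $t\to_v^{(m,e)}p$ means $t$ reduces to $p$ in finitely many $\to_v$ steps, exactly $m$ of them $m$-steps and $e$ of them $e$-steps. Types. Tight types: $\mathtt{tt} ::= \mathtt{n} \mid \mathtt{vl} \mid \mathtt{vr}$. Types $\sigma,\tau ::= \mathtt{tt}\mid\mathcal{M}\mid\mathcal{M}\to\sigma$, with multitypes $\mathcal{M}=[\sigma_i]_{i\in I}$ finite multisets of types ($[\,]$ empty, $\sqcup$ union). Typing contexts $\Gamma$ map variables to multitypes, $[\,]$ for all but finitely many; $(\Gamma+\Delta)(x)=\Gamma(x)\sqcup\Delta(x)$, extended to finite sums; $\Gamma\setminus\!\!\setminus x$ maps $x$ to $[\,]$ and agrees with $\Gamma$ elsewhere. Judgements $\Gamma\vdash^{(m,e,s)} t:\sigma$ carry integer counters. System $\mathcal{V}$ has the rules: (var$_p$) $x:[\mathtt{vr}]\vdash^{(0,0,0)} x:\mathtt{vr}$; (val$_p$) $\emptyset\vdash^{(0,0,0)} x:\mathtt{vl}$; (abs$_p$) $\emptyset\vdash^{(0,0,0)}\lambda x.t:\mathtt{vl}$; (app$_p$) from $\Gamma\vdash^{(m,e,s)} t:\mathtt{tt}_1$ with $\mathtt{tt}_1\in\{\mathtt{vr},\mathtt{n}\}$ and $\Delta\vdash^{(m',e',s')}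 u:\mathtt{tt}_2$ with $\mathtt{tt}_2\in\{\mathtt{vl},\mathtt{n}\}$, infer $\Gamma+\Delta\vdash^{(m+m',e+e',s+s'+1)} t\,u:\mathtt{n}$; (es$_p$) from $\Gamma\vdash^{(m,e,s)} t:\tau$, $\Delta\vdash^{(m',e',s')} u:\mathtt{n}$ and $\Gamma(x)$ tight, infer $(\Gamma\setminus\!\!\setminus x)+\Delta\vdash^{(m+m',e+e',s+s')} t[x\backslash u]:\tau$; (var$_c$) $x:\mathcal{M}\vdash^{(0,1,0)} x:\mathcal{M}$ for any multitype $\mathcal{M}$; (app$_c$) from $\Gamma\vdash^{(m,e,s)} t:[\mathcal{M}\to\tau]$ and $\Delta\vdash^{(m',e',s')} u:\mathcal{M}$, infer $\Gamma+\Delta\vdash^{(m+m'+1,e+e'-1,s+s')} t\,u:\tau$; (appt$_c$) from $\Gamma\vdash^{(m,e,s)} t:[\mathcal{M}\to\tau]$, $\Delta\vdash^{(m',e',s')} u:\mathtt{n}$ and $\mathcal{M}$ tight, infer $\Gamma+\Delta\vdash^{(m+m'+1,e+e'-1,s+s')} t\,u:\tau$; (abs$_c$) from $\Gamma_i\vdash^{(m_i,e_i,s_i)} t:\tau_i$ for each $i\in I$ ($I$ finite, possibly empty), infer $+_{i\in I}(\Gamma_i\setminus\!\!\setminus x)\vdash^{(\sum_i m_i,\,1+\sum_i e_i,\,\sum_i s_i)}\lambda x.t:[\Gamma_i(x)\to\tau_i]_{i\in I}$; (es$_c$) from $\Gamma\vdash^{(m,e,s)} t:\sigma$ and $\Delta\vdash^{(m',e',s')}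 u:\Gamma(x)$, infer $(\Gamma\setminus\!\!\setminus x)+\Delta\vdash^{(m+m',e+e',s+s')} t[x\backslash u]:\sigma$. A multitype is tight if all its elements are tight types; a context is tight if all its multitypes are tight; a derivation of $\Gamma\vdash^{(m,e,s)} t:\sigma$ is tight if $\Gamma$ is tight and $\sigma$ is a tight type. *)

theory Defs
  imports Main "HOL-Library.Multiset" "HOL-Library.Function_Algebras"
begin

text \<open>
  Terms modulo alpha-conversion are represented by de Bruijn indices; a variable is a natural
  number. \<open>ES t u\<close> is the explicit substitution \<open>t[x\u]\<close>; like \<open>Lam t\<close>, it binds index 0 in
  \<open>t\<close> (and nothing in \<open>u\<close>).
\<close>

datatype trm = Var nat | Lam trm | App trm trm | ES trm trm

fun is_value :: "trm \<Rightarrow> bool" where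
  "is_value (Var x) = True"
| "is_value (Lam t) = True"
| "is_value (App t u) = False"
| "is_value (ES t u) = False"

text \<open>\<open>lift n c t\<close> adds \<open>n\<close> to all free indices \<open>\<ge> c\<close> of \<open>t\<close>.\<close>

primrec lift :: "nat \<Rightarrow> nat \<Rightarrow> trm \<Rightarrow> trm" where
  "lift n c (Var i) = (if i < c then Var i else Var (i + n))"
| "lift n c (Lam t) = Lam (lift n (Suc c) t)"
| "lift n c (App t u) = App (lift n c t) (lift n c u)"
| "lift n c (ES t u) = ES (lift n (Suc c) t) (lift n c u)"

text \<open>
  \<open>subst t k v\<close> replaces index \<open>k\<close> of \<open>t\<close> by \<open>v\<close> and removes \<open>k\<close> from the scope: larger indices
  are decremented. So \<open>subst t 0 v\<close> is \<open>t{x:=v}\<close> for the body \<open>t\<close> of a binder of \<open>x\<close>.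
\<close>

primrec subst :: "trm \<Rightarrow> nat \<Rightarrow> trm \<Rightarrow> trm" where
  "subst (Var i) k v = (if i < k then Var i else if i = k then v else Var (i - 1))"
| "subst (Lam t) k v = Lam (subst t (Suc k) (lift 1 0 v))"
| "subst (App t u) k v = App (subst t k v) (subst u k v)"
| "subst (ES t u) k v = ES (subst t (Suc k) (lift 1 0 v)) (subst u k v)"

primrec v_size :: "trm \<Rightarrow> nat" where
  "v_size (Var x) = 0"
| "v_size (Lam t) = 0"
| "v_size (App t u) = v_size t + v_size u + 1"
| "v_size (ES t u) = v_size t + v_size u"

inductive vr_v :: "trm \<Rightarrow> bool" and ne_v :: "trm \<Rightarrow> bool" and no_v :: "trm \<Rightarrow> bool" where
  vr_Var: "vr_v (Var x)"
| vr_ES: "vr_v t \<Longrightarrow> ne_v u \<Longrightarrow> vr_v (ES t u)"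
| ne_App_vr: "vr_v t \<Longrightarrow> no_v u \<Longrightarrow> ne_v (App t u)"
| ne_App_ne: "ne_v t \<Longrightarrow> no_v u \<Longrightarrow> ne_v (App t u)"
| ne_ES: "ne_v t \<Longrightarrow> ne_v u \<Longrightarrow> ne_v (ES t u)"
| no_Lam: "no_v (Lam t)"
| no_vr: "vr_v t \<Longrightarrow> no_v t"
| no_ne: "ne_v t \<Longrightarrow> no_v t"
| no_ES: "no_v t \<Longrightarrow> ne_v u \<Longrightarrow> no_v (ES t u)"

text \<open>
  List contexts \<open>L\<close>. The term plugged into \<open>L\<close> lies under \<open>lctx_depth L\<close> binders.
\<close>

datatype lctx = LHole | LES lctx trm

primrec lplug :: "lctx \<Rightarrow> trm \<Rightarrow> trm" where
  "lplug LHole t = t"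
| "lplug (LES L u) t = ES (lplug L t) u"

primrec lctx_depth :: "lctx \<Rightarrow> nat" where
  "lctx_depth LHole = 0"
| "lctx_depth (LES L u) = Suc (lctx_depth L)"

text \<open>
  In both root rules a subterm moves into the scope of the binders of \<open>L\<close>, which must not capture
  its free variables: it is lifted by the depth of \<open>L\<close>. In \<open>sv\<close> that subterm is \<open>t\<close>, whose own
  index 0 is the variable being substituted; hence the cutoff 1.
\<close>

inductive dB :: "trm \<Rightarrow> trm \<Rightarrow> bool" where
  "dB (App (lplug L (Lam t)) u) (lplug L (ES t (lift (lctx_depth L) 0 u)))"

inductive sv :: "trm \<Rightarrow> trm \<Rightarrow> bool" where
  "is_value v \<Longrightarrow> sv (ES t (lplug L v)) (lplug L (subst (lift (lctx_depth L) 1 t) 0 v))"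

text \<open>CBV contexts; plugging may capture, so no lifting takes place.\<close>

datatype vctx = VHole | VAppL vctx trm | VAppR trm vctx | VESL vctx trm | VESR trm vctx

primrec vplug :: "vctx \<Rightarrow> trm \<Rightarrow> trm" where
  "vplug VHole t = t"
| "vplug (VAppL V u) t = App (vplug V t) u"
| "vplug (VAppR u V) t = App u (vplug V t)"
| "vplug (VESL V u) t = ES (vplug V t) u"
| "vplug (VESR u V) t = ES u (vplug V t)"

inductive m_step :: "trm \<Rightarrow> trm \<Rightarrow> bool" where
  "dB t u \<Longrightarrow> m_step (vplug V t) (vplug V u)"

inductive e_step :: "trm \<Rightarrow> trm \<Rightarrow> bool" where
  "sv t u \<Longrightarrow> e_step (vplug V t) (vplug V u)"

text \<open>\<open>reds t m e p\<close> is \<open>t \<rightarrow>\<^sub>v\<^sup>(\<^sup>m\<^sup>,\<^sup>e\<^sup>) p\<close>.\<close>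

inductive reds :: "trm \<Rightarrow> nat \<Rightarrow> nat \<Rightarrow> trm \<Rightarrow> bool" where
  reds_refl: "reds t 0 0 t"
| reds_m: "m_step t u \<Longrightarrow> reds u m e p \<Longrightarrow> reds t (Suc m) e p"
| reds_e: "e_step t u \<Longrightarrow> reds u m e p \<Longrightarrow> reds t m (Suc e) p"

datatype tt = TN | TVl | TVr

datatype ty = Tt tt | MT "ty multiset" | Arr "ty multiset" ty

type_synonym tctx = "nat \<Rightarrow> ty multiset"

definition fin_ctx :: "tctx \<Rightarrow> bool" where
  "fin_ctx \<Gamma> \<longleftrightarrow> finite {x. \<Gamma> x \<noteq> {#}}"

definition tight_ty :: "ty \<Rightarrow> bool" where
  "tight_ty \<sigma> \<longleftrightarrow> (\<exists>a. \<sigma> = Tt a)"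

definition tight_mty :: "ty multiset \<Rightarrow> bool" where
  "tight_mty M \<longleftrightarrow> (\<forall>\<sigma> \<in># M. tight_ty \<sigma>)"

definition tight_ctx :: "tctx \<Rightarrow> bool" where
  "tight_ctx \<Gamma> \<longleftrightarrow> (\<forall>x. tight_mty (\<Gamma> x))"

definition empty_ctx :: tctx where
  "empty_ctx = (\<lambda>_. {#})"

definition single_ctx :: "nat \<Rightarrow> ty multiset \<Rightarrow> tctx" where
  "single_ctx x M = empty_ctx(x := M)"

text \<open>
  A context \<open>\<Gamma>\<close> for the body of a binder assigns \<open>\<Gamma> 0\<close> to the bound variable; outside the
  binder, where that variable is gone, \<open>\<Gamma> \<setminus>\<setminus> x\<close> becomes \<open>pop \<Gamma>\<close>. Addition of contexts is
  pointwise, from the function algebra.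
\<close>

definition pop :: "tctx \<Rightarrow> tctx" where
  "pop \<Gamma> = (\<lambda>x. \<Gamma> (Suc x))"

text \<open>
  Every derivable context is \<open>fin_ctx\<close>: axioms have contexts with at most one nonempty entry, and
  the other rules form finite sums. The multitype \<open>M\<close> used as a type is \<open>MT M\<close>.
\<close>

inductive typing :: "tctx \<Rightarrow> int \<Rightarrow> int \<Rightarrow> int \<Rightarrow> trm \<Rightarrow> ty \<Rightarrow> bool"
    ("_ \<turnstile>'(_,_,_') _ \<Colon> _" [51,0,0,0,51,51] 50) where
  var_p: "single_ctx x {#Tt TVr#} \<turnstile>(0,0,0) Var x \<Colon> Tt TVr"
| val_p: "empty_ctx \<turnstile>(0,0,0) Var x \<Colon> Tt TVl"
| abs_p: "empty_ctx \<turnstile>(0,0,0) Lam t \<Colon> Tt TVl"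
| app_p: "\<Gamma> \<turnstile>(m,e,s) t \<Colon> Tt a \<Longrightarrow> a \<in> {TVr, TN} \<Longrightarrow>
    \<Delta> \<turnstile>(m',e',s') u \<Colon> Tt b \<Longrightarrow> b \<in> {TVl, TN} \<Longrightarrow>
    \<Gamma> + \<Delta> \<turnstile>(m + m', e + e', s + s' + 1) App t u \<Colon> Tt TN"
| es_p: "\<Gamma> \<turnstile>(m,e,s) t \<Colon> \<tau> \<Longrightarrow> \<Delta> \<turnstile>(m',e',s') u \<Colon> Tt TN \<Longrightarrow> tight_mty (\<Gamma> 0) \<Longrightarrow>
    pop \<Gamma> + \<Delta> \<turnstile>(m + m', e + e', s + s') ES t u \<Colon> \<tau>"
| var_c: "single_ctx x M \<turnstile>(0,1,0) Var x \<Colon> MT M"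
| app_c: "\<Gamma> \<turnstile>(m,e,s) t \<Colon> MT {#Arr M \<tau>#} \<Longrightarrow> \<Delta> \<turnstile>(m',e',s') u \<Colon> MT M \<Longrightarrow>
    \<Gamma> + \<Delta> \<turnstile>(m + m' + 1, e + e' - 1, s + s') App t u \<Colon> \<tau>"
| appt_c: "\<Gamma> \<turnstile>(m,e,s) t \<Colon> MT {#Arr M \<tau>#} \<Longrightarrow> \<Delta> \<turnstile>(m',e',s') u \<Colon> Tt TN \<Longrightarrow> tight_mty M \<Longrightarrow>
    \<Gamma> + \<Delta> \<turnstile>(m + m' + 1, e + e' - 1, s + s') App t u \<Colon> \<tau>"
| abs_c: "finite (I :: nat set) \<Longrightarrow>
    (\<And>i. i \<in> I \<Longrightarrow> \<Gamma>s i \<turnstile>(ms i, es i, ss i) t \<Colon> \<tau>s i) \<Longrightarrow>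
    (\<Sum>i\<in>I. pop (\<Gamma>s i)) \<turnstile>(\<Sum>i\<in>I. ms i, 1 + (\<Sum>i\<in>I. es i), \<Sum>i\<in>I. ss i)
      Lam t \<Colon> MT {#Arr (\<Gamma>s i 0) (\<tau>s i). i \<in># mset_set I#}"
| es_c: "\<Gamma> \<turnstile>(m,e,s) t \<Colon> \<sigma> \<Longrightarrow> \<Delta> \<turnstile>(m',e',s') u \<Colon> MT (\<Gamma> 0) \<Longrightarrow>
    pop \<Gamma> + \<Delta> \<turnstile>(m + m', e + e', s + s') ES t u \<Colon> \<sigma>"

end

theory Submission
  imports Defs
begin

text \<open>
  The proof is by subject expansion along the reduction sequence. A normal form has a tight
  derivation with counters \<open>(0, 0, |p|)\<close>. Expanding an \<open>m\<close>-step adds one to the first counter, as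
  \<open>app_c\<close> and \<open>appt_c\<close> do, while the unit that \<open>abs_c\<close> adds to the second one is taken back by the
  application. Expanding an \<open>e\<close>-step adds one to the second counter: the derivations of all the
  copies of a value merge into a single one, whose root counts 1 instead of 1 per copy,
  and each copy removed from the body leaves behind an axiom for the variable.
  A derivation types the hole of a CBV context exactly once, so the root cases propagate.
\<close>

section \<open>Inversion and replay of the typing rules\<close>

inductive_cases typing_VarE [consumes 1]: "\<Gamma> \<turnstile>(m,e,s) Var x \<Colon> \<tau>"
inductive_cases typing_LamE [consumes 1]: "\<Gamma> \<turnstile>(m,e,s) Lam t \<Colon> \<tau>"
inductive_cases typing_AppE [consumes 1]: "\<Gamma> \<turnstile>(m,e,s) App t u \<Colon> \<tau>"
inductive_cases typing_ESE [consumes 1]: "\<Gamma> \<turnstile>(m,e,s) ES t u \<Colon> \<tau>"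

text \<open>Separates a derivation from the arithmetic of its counters, since the rules only produce
  sums.\<close>

lemma typing_cong:
  assumes "\<Gamma> \<turnstile>(m,e,s) t \<Colon> \<tau>" "\<Gamma> = \<Gamma>'" "m = m'" "e = e'" "s = s'" "\<tau> = \<tau>'"
  shows "\<Gamma>' \<turnstile>(m',e',s') t \<Colon> \<tau>'"
  using assms by simp

text \<open>The two ways to type an argument meant for a variable or an arrow of multitype \<open>M\<close>.\<close>

definition arg_type :: "ty multiset \<Rightarrow> ty \<Rightarrow> bool" where
  "arg_type M \<sigma> \<longleftrightarrow> \<sigma> = MT M \<or> \<sigma> = Tt TN \<and> tight_mty M"

lemma typing_ES:
  assumes "\<Gamma> \<turnstile>(m,e,s) t \<Colon> \<tau>" "\<Delta> \<turnstile>(m',e',s') u \<Colon> \<sigma>" "arg_type (\<Gamma> 0) \<sigma>"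
  shows "pop \<Gamma> + \<Delta> \<turnstile>(m + m', e + e', s + s') ES t u \<Colon> \<tau>"
  using assms by (auto simp: arg_type_def intro: typing.es_c typing.es_p)

lemma typing_ES_cases [consumes 1]:
  assumes "\<Gamma> \<turnstile>(m,e,s) ES t u \<Colon> \<tau>"
  obtains \<Gamma>1 m1 e1 s1 \<Gamma>2 m2 e2 s2 \<sigma> where
    "\<Gamma>1 \<turnstile>(m1,e1,s1) t \<Colon> \<tau>" "\<Gamma>2 \<turnstile>(m2,e2,s2) u \<Colon> \<sigma>" "arg_type (\<Gamma>1 0) \<sigma>"
    "\<Gamma> = pop \<Gamma>1 + \<Gamma>2" "m = m1 + m2" "e = e1 + e2" "s = s1 + s2"
  using assms
proof (cases rule: typing_ESE)
  case (1 \<Gamma>1 m1 e1 s1 \<Gamma>2 m2 e2 s2)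
  show thesis by (rule that[OF 1(5,6) _ 1(1-4)]) (simp add: arg_type_def 1(7))
next
  case (2 \<Gamma>1 m1 e1 s1 \<Gamma>2 m2 e2 s2)
  show thesis by (rule that[OF 2(5,6) _ 2(1-4)]) (simp add: arg_type_def)
qed

lemma typing_App:
  assumes "\<Gamma> \<turnstile>(m,e,s) t \<Colon> MT {#Arr M \<tau>#}" "\<Delta> \<turnstile>(m',e',s') u \<Colon> \<sigma>" "arg_type M \<sigma>"
  shows "\<Gamma> + \<Delta> \<turnstile>(m + m' + 1, e + e' - 1, s + s') App t u \<Colon> \<tau>"
  using assms by (auto simp: arg_type_def intro: typing.app_c typing.appt_c)

text \<open>
  No application rule looks at the two subterms or at their contexts, so the last step of a
  derivation can be replayed on any others of the same types.
\<close>

lemma typing_App_cases [consumes 1]: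
  assumes "\<Gamma> \<turnstile>(m,e,s) App t u \<Colon> \<tau>"
  obtains \<Gamma>1 m1 e1 s1 \<sigma>1 \<Gamma>2 m2 e2 s2 \<sigma>2 a b c where
    "\<Gamma>1 \<turnstile>(m1,e1,s1) t \<Colon> \<sigma>1" "\<Gamma>2 \<turnstile>(m2,e2,s2) u \<Colon> \<sigma>2"
    "\<Gamma> = \<Gamma>1 + \<Gamma>2" "m = m1 + m2 + a" "e = e1 + e2 + b" "s = s1 + s2 + c"
    "\<And>\<Gamma>1 m1 e1 s1 t \<Gamma>2 m2 e2 s2 u. \<Gamma>1 \<turnstile>(m1,e1,s1) t \<Colon> \<sigma>1 \<Longrightarrow> \<Gamma>2 \<turnstile>(m2,e2,s2) u \<Colon> \<sigma>2 \<Longrightarrow>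
      \<Gamma>1 + \<Gamma>2 \<turnstile>(m1 + m2 + a, e1 + e2 + b, s1 + s2 + c) App t u \<Colon> \<tau>"
  using assms
proof (cases rule: typing_AppE)
  case (1 \<Gamma>1 m1 e1 s1 a \<Gamma>2 m2 e2 s2 b)
  show thesis
  \<comment> \<open>The instances are what the rule itself adds to the three counters: here a unit
    of size, in the two consuming cases below \<open>1\<close> and \<open>-1\<close> for the step
    counters.\<close>
  proof (rule that[OF 1(6,8,1), of 0 0 1])
    fix \<Gamma>1 m1 e1 s1 t \<Gamma>2 m2 e2 s2 u
    assume "\<Gamma>1 \<turnstile>(m1,e1,s1) t \<Colon> Tt a" "\<Gamma>2 \<turnstile>(m2,e2,s2) u \<Colon> Tt b"
    from typing.app_p[OF this(1) _ this(2)] 1(5,7,9)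
    show "\<Gamma>1 + \<Gamma>2 \<turnstile>(m1 + m2 + 0, e1 + e2 + 0, s1 + s2 + 1) App t u \<Colon> \<tau>" by simp
  qed (simp_all add: 1)
next
  case (2 \<Gamma>1 m1 e1 s1 M \<Gamma>2 m2 e2 s2)
  show thesis
  proof (rule that[OF 2(5,6,1), of 1 "-1" 0])
    fix \<Gamma>1 m1 e1 s1 t \<Gamma>2 m2 e2 s2 u
    assume "\<Gamma>1 \<turnstile>(m1,e1,s1) t \<Colon> MT {#Arr M \<tau>#}" "\<Gamma>2 \<turnstile>(m2,e2,s2) u \<Colon> MT M"
    from typing.app_c[OF this]
    show "\<Gamma>1 + \<Gamma>2 \<turnstile>(m1 + m2 + 1, e1 + e2 + - 1, s1 + s2 + 0) App t u \<Colon> \<tau>" by simp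
  qed (simp_all add: 2)
next
  case (3 \<Gamma>1 m1 e1 s1 M \<Gamma>2 m2 e2 s2)
  show thesis
  proof (rule that[OF 3(5,6,1), of 1 "-1" 0])
    fix \<Gamma>1 m1 e1 s1 t \<Gamma>2 m2 e2 s2 u
    assume "\<Gamma>1 \<turnstile>(m1,e1,s1) t \<Colon> MT {#Arr M \<tau>#}" "\<Gamma>2 \<turnstile>(m2,e2,s2) u \<Colon> Tt TN"
    from typing.appt_c[OF this 3(7)]
    show "\<Gamma>1 + \<Gamma>2 \<turnstile>(m1 + m2 + 1, e1 + e2 + - 1, s1 + s2 + 0) App t u \<Colon> \<tau>" by simp
  qed (simp_all add: 3)
qed

section \<open>Typing contexts\<close>

text \<open>
  The elimination and induction rules of \<open>typing\<close> carry eta-expanded contexts, on which the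
  pointwise rules for \<open>+\<close> and \<open>0\<close> would fire.
\<close>

declare plus_fun_apply [simp del] zero_fun_apply [simp del]

text \<open>The inverse of lifting on contexts; \<open>ctx_drop 1 0\<close> is \<open>pop\<close>.\<close>

definition ctx_drop :: "nat \<Rightarrow> nat \<Rightarrow> tctx \<Rightarrow> tctx" where
  "ctx_drop n c \<Gamma> = (\<lambda>x. if x < c then \<Gamma> x else \<Gamma> (x + n))"

lemma ctx_drop_add: "ctx_drop n c (\<Gamma> + \<Delta>) = ctx_drop n c \<Gamma> + ctx_drop n c \<Delta>"
  by (auto simp: ctx_drop_def fun_eq_iff plus_fun_apply zero_fun_apply)

lemma ctx_drop_zero [simp]: "ctx_drop n c 0 = 0"
  by (auto simp: ctx_drop_def fun_eq_iff plus_fun_apply zero_fun_apply)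

lemma pop_add: "pop (\<Gamma> + \<Delta>) = pop \<Gamma> + pop \<Delta>"
  by (auto simp: pop_def fun_eq_iff plus_fun_apply zero_fun_apply)

lemma pop_ctx_drop: "pop (ctx_drop n (Suc c) \<Gamma>) = ctx_drop n c (pop \<Gamma>)"
  by (auto simp: pop_def ctx_drop_def fun_eq_iff plus_fun_apply zero_fun_apply)

lemma ctx_drop_Suc_0 [simp]: "ctx_drop n (Suc c) \<Gamma> 0 = \<Gamma> 0"
  by (simp add: ctx_drop_def)

lemma ctx_drop_1_0: "ctx_drop (Suc 0) 0 \<Gamma> = pop \<Gamma>"
  by (simp add: ctx_drop_def pop_def)

lemma empty_ctx_eq_0: "empty_ctx = 0"
  by (simp add: empty_ctx_def fun_eq_iff plus_fun_apply zero_fun_apply)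

lemma single_ctx_apply: "single_ctx x M y = (if y = x then M else {#})"
  by (simp add: single_ctx_def empty_ctx_def)

lemma single_ctx_add: "single_ctx x M + single_ctx x N = single_ctx x (M + N)"
  by (auto simp: single_ctx_apply fun_eq_iff plus_fun_apply zero_fun_apply)

lemma single_ctx_empty: "single_ctx x {#} = 0"
  by (auto simp: single_ctx_apply fun_eq_iff plus_fun_apply zero_fun_apply)

lemma ctx_drop_single_same: "ctx_drop (Suc 0) k (single_ctx k M) = 0"
  by (auto simp: ctx_drop_def single_ctx_apply fun_eq_iff zero_fun_apply)

lemma ctx_drop_single_neq:
  "x \<noteq> k \<Longrightarrow> ctx_drop (Suc 0) k (single_ctx x M) = single_ctx (if x < k then x else x - 1) M"
  by (auto simp: ctx_drop_def single_ctx_apply fun_eq_iff)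

lemma fin_ctx_add: "fin_ctx \<Gamma> \<Longrightarrow> fin_ctx \<Delta> \<Longrightarrow> fin_ctx (\<Gamma> + \<Delta>)"
  unfolding fin_ctx_def
  by (rule finite_subset[of _ "{x. \<Gamma> x \<noteq> {#}} \<union> {x. \<Delta> x \<noteq> {#}}"]) (auto simp: plus_fun_apply zero_fun_apply)

lemma fin_ctx_pop: "fin_ctx \<Gamma> \<Longrightarrow> fin_ctx (pop \<Gamma>)"
  unfolding fin_ctx_def pop_def
  using finite_vimageI[of "{x. \<Gamma> x \<noteq> {#}}" Suc] by (simp add: vimage_def)

lemma fin_ctx_zero: "fin_ctx 0"
  by (simp add: fin_ctx_def plus_fun_apply zero_fun_apply)

lemma fin_ctx_single: "fin_ctx (single_ctx x M)"
  unfolding fin_ctx_def by (rule finite_subset[of _ "{x}"]) (auto simp: single_ctx_apply)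

lemma fin_ctx_sum: "(\<And>i. i \<in> I \<Longrightarrow> fin_ctx (f i)) \<Longrightarrow> fin_ctx (\<Sum>i\<in>I. f i)"
  by (induction I rule: infinite_finite_induct) (auto simp: fin_ctx_zero fin_ctx_add)

lemma typing_fin_ctx: "\<Gamma> \<turnstile>(m,e,s) t \<Colon> \<tau> \<Longrightarrow> fin_ctx \<Gamma>"
  by (induction rule: typing.induct)
    (simp_all add: fin_ctx_single empty_ctx_eq_0 fin_ctx_zero fin_ctx_add fin_ctx_pop fin_ctx_sum)

section \<open>Multitypes of values\<close>

lemma typing_Lam_nil: "0 \<turnstile>(0,1,0) Lam t \<Colon> MT {#}"
  using typing.abs_c[of "{}" "\<lambda>_. 0" "\<lambda>_. 0" "\<lambda>_. 0" "\<lambda>_. 0" t "\<lambda>_. Tt TN"] by simp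

text \<open>A fresh index enlarges the family of \<open>abs_c\<close> by one member. The unit of the
  root is already part of \<open>e'\<close>, so the counters simply add.\<close>

lemma typing_Lam_add:
  assumes "\<Gamma> \<turnstile>(m,e,s) t \<Colon> \<tau>" and "\<Delta> \<turnstile>(m',e',s') Lam t \<Colon> MT M"
  shows "pop \<Gamma> + \<Delta> \<turnstile>(m + m', e + e', s + s') Lam t \<Colon> MT (add_mset (Arr (\<Gamma> 0) \<tau>) M)"
  using assms(2)
proof (cases rule: typing_LamE)
  case (2 I \<Gamma>s ms es ss \<tau>s)
  obtain j where j: "j \<notin> I" using ex_new_if_finite[OF infinite_UNIV_nat 2(6)] by blast
  have upd: "(\<Sum>i\<in>insert j I. g ((f(j := a)) i)) = g a + (\<Sum>i\<in>I. g (f i))"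
    for f :: "nat \<Rightarrow> 'b" and g :: "'b \<Rightarrow> 'c::comm_monoid_add" and a
    using 2(6) j by (simp, intro arg_cong2[where f = "(+)"] sum.cong) auto
  have img: "{#Arr ((\<Gamma>s(j := \<Gamma>)) i 0) ((\<tau>s(j := \<tau>)) i). i \<in># mset_set (insert j I)#}
    = add_mset (Arr (\<Gamma> 0) \<tau>) M"
    using 2 j by (auto intro!: image_mset_cong)
  have "(\<Sum>i\<in>insert j I. pop ((\<Gamma>s(j := \<Gamma>)) i)) \<turnstile>(\<Sum>i\<in>insert j I. (ms(j := m)) i,
      1 + (\<Sum>i\<in>insert j I. (es(j := e)) i), \<Sum>i\<in>insert j I. (ss(j := s)) i)
      Lam t \<Colon> MT {#Arr ((\<Gamma>s(j := \<Gamma>)) i 0) ((\<tau>s(j := \<tau>)) i). i \<in># mset_set (insert j I)#}"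
    by (rule typing.abs_c) (use 2 assms(1) in auto)
  then show ?thesis
    unfolding img
    by (rule typing_cong) (use 2 upd[of pop] upd[of "\<lambda>x. x"] in simp_all)
qed simp

text \<open>Takes a family of \<open>abs_c\<close> apart one member at a time, so that later proofs
  need not handle indexed sums.\<close>

lemma typing_Lam_induct [consumes 1, case_names nil add]:
  assumes "\<Gamma> \<turnstile>(m,e,s) Lam t \<Colon> MT M"
    and nil: "P 0 0 1 0 {#}"
    and add: "\<And>\<Gamma> m e s \<tau> \<Delta> m' e' s' M. \<Gamma> \<turnstile>(m,e,s) t \<Colon> \<tau> \<Longrightarrow> \<Delta> \<turnstile>(m',e',s') Lam t \<Colon> MT M \<Longrightarrow>
      P \<Delta> m' e' s' M \<Longrightarrow>
      P (pop \<Gamma> + \<Delta>) (m + m') (e + e') (s + s') (add_mset (Arr (\<Gamma> 0) \<tau>) M)"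
  shows "P \<Gamma> m e s M"
  using assms(1)
proof (cases rule: typing_LamE)
  case (2 I \<Gamma>s ms es ss \<tau>s)
  \<comment> \<open>Generalised to the subsets of \<open>I\<close>: every subfamily again types the
    abstraction, as the premise \<open>add\<close> requires.\<close>
  have "J \<subseteq> I \<Longrightarrow> P (\<Sum>i\<in>J. pop (\<Gamma>s i)) (\<Sum>i\<in>J. ms i) (1 + (\<Sum>i\<in>J. es i)) (\<Sum>i\<in>J. ss i)
      {#Arr (\<Gamma>s i 0) (\<tau>s i). i \<in># mset_set J#}" if "finite J" for J
    using that
  proof (induction J rule: finite_induct)
    case empty
    show ?case using nil by simp
  next
    case (insert j J)
    have "(\<Sum>i\<in>J. pop (\<Gamma>s i)) \<turnstile>(\<Sum>i\<in>J. ms i, 1 + (\<Sum>i\<in>J. es i), \<Sum>i\<in>J. ss i)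
      Lam t \<Colon> MT {#Arr (\<Gamma>s i 0) (\<tau>s i). i \<in># mset_set J#}"
      by (rule typing.abs_c) (use 2 insert in auto)
    from add[OF 2(7)[of j] this] insert show ?case
      by (simp add: algebra_simps)
  qed
  from this[of I] 2 show ?thesis by simp
qed simp

text \<open>The derivation for a value of which no copy is used. Its unit accounts for the
  \<open>sv\<close>-step that erases it.\<close>

lemma typing_value_nil: "is_value v \<Longrightarrow> 0 \<turnstile>(0,1,0) v \<Colon> MT {#}"
  by (cases v) (use typing.var_c[of _ "{#}"] typing_Lam_nil in \<open>auto simp: single_ctx_empty\<close>)

text \<open>Two \<open>var_c\<close> axioms fuse into one, and two families of \<open>abs_c\<close>
  are put under one root. Each derivation counts its root, so one of the two units goes.\<close>

lemma typing_value_merge: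
  assumes "is_value v" and "\<Gamma> \<turnstile>(m,e,s) v \<Colon> MT M" and "\<Delta> \<turnstile>(m',e',s') v \<Colon> MT N"
  shows "\<Gamma> + \<Delta> \<turnstile>(m + m', e + e' - 1, s + s') v \<Colon> MT (M + N)"
proof (cases v)
  case (Var x)
  show ?thesis
    using assms(2,3) unfolding Var
    by (auto elim!: typing_VarE simp: single_ctx_add intro: typing.var_c)
next
  case (Lam t)
  show ?thesis
    using assms(2) unfolding Lam
  \<comment> \<open>The members of the first family move one by one into the second; in the end only
    the first root's unit is left, and it is subtracted.\<close>
  proof (induction rule: typing_Lam_induct)
    case nil
    then show ?case using assms(3) Lam by simp
  next
    case (add \<Gamma> m e s \<tau> \<Delta>' m'' e'' s'' M)
    from typing_Lam_add[OF add(1) add(3)] show ?case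
      by (rule typing_cong) (simp_all add: algebra_simps)
  qed
qed (use assms in auto)

section \<open>Lifting\<close>

lemma lift_lift: "lift n c (lift m c t) = lift (m + n) c t"
  by (induction t arbitrary: c) auto

definition vacuous :: "nat \<Rightarrow> nat \<Rightarrow> tctx \<Rightarrow> bool" where
  "vacuous n c \<Gamma> \<longleftrightarrow> (\<forall>x. c \<le> x \<and> x < c + n \<longrightarrow> \<Gamma> x = {#})"

lemma vacuous_add: "vacuous n c \<Gamma> \<Longrightarrow> vacuous n c \<Delta> \<Longrightarrow> vacuous n c (\<Gamma> + \<Delta>)"
  by (simp add: vacuous_def plus_fun_apply)

lemma vacuous_pop: "vacuous n (Suc c) \<Gamma> \<Longrightarrow> vacuous n c (pop \<Gamma>)"
  by (simp add: vacuous_def pop_def)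

lemma vacuous_zero [simp]: "vacuous n c 0"
  by (simp add: vacuous_def zero_fun_apply)

text \<open>A lifted term does not contain the skipped indices, and without weakening only occurring
  variables get nonempty multitypes. The vacuity is used as well: a subterm that was moved under
  binders demands nothing of them.\<close>

lemma typing_unlift:
  "\<Gamma> \<turnstile>(m,e,s) lift n c t \<Colon> \<tau> \<Longrightarrow> vacuous n c \<Gamma> \<and> ctx_drop n c \<Gamma> \<turnstile>(m,e,s) t \<Colon> \<tau>"
proof (induction t arbitrary: \<Gamma> m e s c \<tau>)
  case (Var x)
  define y where "y = (if x < c then x else x + n)"
  have drop: "ctx_drop n c (single_ctx y M) = single_ctx x M" and "vacuous n c (single_ctx y M)" for M
    by (auto simp: ctx_drop_def single_ctx_apply y_def fun_eq_iff vacuous_def)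
  moreover have y: "\<Gamma> \<turnstile>(m,e,s) Var y \<Colon> \<tau>" using Var by (simp add: y_def split: if_splits)
  ultimately show ?case
    using typing.var_p[of x] typing.val_p[of x] typing.var_c[of x]
    by - (rule typing_VarE[OF y], simp_all add: empty_ctx_eq_0)
next
  case (Lam t)
  from Lam.prems have "\<Gamma> \<turnstile>(m,e,s) Lam (lift n (Suc c) t) \<Colon> \<tau>" by simp
  then show ?case
  proof (cases rule: typing_LamE)
    case 1
    then show ?thesis using typing.abs_p by (simp add: empty_ctx_eq_0)
  next
    case (2 I \<Gamma>s ms es ss \<tau>s)
    then obtain M where \<tau>: "\<tau> = MT M" by blast
    from Lam.prems have "\<Gamma> \<turnstile>(m,e,s) Lam (lift n (Suc c) t) \<Colon> MT M" by (simp add: \<tau>)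
    then show ?thesis unfolding \<tau>
    proof (induction rule: typing_Lam_induct)
      case nil
      show ?case by (simp add: typing_Lam_nil)
    next
      case (add \<Gamma> m e s \<tau> \<Delta> m' e' s' M)
      then show ?case
        using Lam.IH[OF add(1)] typing_Lam_add[of "ctx_drop n (Suc c) \<Gamma>" m e s t \<tau> "ctx_drop n c \<Delta>" m' e' s' M]
        by (simp add: vacuous_add vacuous_pop ctx_drop_add pop_ctx_drop)
    qed
  qed
next
  case (App t u)
  from App.prems have "\<Gamma> \<turnstile>(m,e,s) App (lift n c t) (lift n c u) \<Colon> \<tau>" by simp
  then show ?case
  proof (cases rule: typing_App_cases)
    case (1 \<Gamma>1 m1 e1 s1 \<sigma>1 \<Gamma>2 m2 e2 s2 \<sigma>2 a b c')
    have t: "vacuous n c \<Gamma>1" "ctx_drop n c \<Gamma>1 \<turnstile>(m1,e1,s1) t \<Colon> \<sigma>1"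
      and u: "vacuous n c \<Gamma>2" "ctx_drop n c \<Gamma>2 \<turnstile>(m2,e2,s2) u \<Colon> \<sigma>2"
      using App.IH(1)[OF 1(1)] App.IH(2)[OF 1(2)] by simp_all
    from 1(7)[OF t(2) u(2)] show ?thesis
      using t(1) u(1) 1(3-6) by (simp add: vacuous_add ctx_drop_add)
  qed
next
  case (ES t u)
  from ES.prems have "\<Gamma> \<turnstile>(m,e,s) ES (lift n (Suc c) t) (lift n c u) \<Colon> \<tau>" by simp
  then show ?case
  proof (cases rule: typing_ES_cases)
    case (1 \<Gamma>1 m1 e1 s1 \<Gamma>2 m2 e2 s2 \<sigma>)
    have t: "vacuous n (Suc c) \<Gamma>1" "ctx_drop n (Suc c) \<Gamma>1 \<turnstile>(m1,e1,s1) t \<Colon> \<tau>"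
      and u: "vacuous n c \<Gamma>2" "ctx_drop n c \<Gamma>2 \<turnstile>(m2,e2,s2) u \<Colon> \<sigma>"
      using ES.IH(1)[OF 1(1)] ES.IH(2)[OF 1(2)] by simp_all
    from typing_ES[OF t(2) u(2)] 1(3) show ?thesis
      using t(1) u(1) 1(4-7) by (simp add: vacuous_add vacuous_pop ctx_drop_add pop_ctx_drop)
  qed
qed

section \<open>Anti-substitution\<close>

text \<open>The shape of anti-substitution: one derivation of the body and a single one of
  \<open>v\<close> for all its copies. By the \<open>- 1\<close> the parts count one exponential
  unit more than the whole, namely the \<open>sv\<close>-step being undone. \<open>v\<close> ranges
  over all terms, as \<open>lplug L v\<close> is also put there.\<close>

definition subst_split ::
  "trm \<Rightarrow> nat \<Rightarrow> trm \<Rightarrow> ty \<Rightarrow> tctx \<Rightarrow> int \<Rightarrow> int \<Rightarrow> int \<Rightarrow> bool" where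
  "subst_split t k v \<tau> \<Gamma>' m e s \<longleftrightarrow> (\<exists>\<Gamma> \<Delta> m1 e1 s1 m2 e2 s2.
    \<Gamma> \<turnstile>(m1,e1,s1) t \<Colon> \<tau> \<and> \<Delta> \<turnstile>(m2,e2,s2) v \<Colon> MT (\<Gamma> k) \<and>
    \<Gamma>' = ctx_drop 1 k \<Gamma> + \<Delta> \<and> m = m1 + m2 \<and> e = e1 + e2 - 1 \<and> s = s1 + s2)"

lemma subst_splitI:
  assumes "\<Gamma> \<turnstile>(m1,e1,s1) t \<Colon> \<tau>" "\<Delta> \<turnstile>(m2,e2,s2) v \<Colon> MT (\<Gamma> k)"
    "\<Gamma>' = ctx_drop 1 k \<Gamma> + \<Delta>" "m = m1 + m2" "e = e1 + e2 - 1" "s = s1 + s2"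
  shows "subst_split t k v \<tau> \<Gamma>' m e s"
  using assms unfolding subst_split_def by blast

lemma subst_splitE:
  assumes "subst_split t k v \<tau> \<Gamma>' m e s"
  obtains \<Gamma> \<Delta> m1 e1 s1 m2 e2 s2 where
    "\<Gamma> \<turnstile>(m1,e1,s1) t \<Colon> \<tau>" "\<Delta> \<turnstile>(m2,e2,s2) v \<Colon> MT (\<Gamma> k)"
    "\<Gamma>' = ctx_drop 1 k \<Gamma> + \<Delta>" "m = m1 + m2" "e = e1 + e2 - 1" "s = s1 + s2"
  using assms unfolding subst_split_def by blast

text \<open>Nothing is demanded of \<open>v\<close>, so it gets the empty multitype, and the unit of
  that derivation cancels against the \<open>- 1\<close>.\<close>

lemma subst_split_trivial:
  assumes "\<Gamma> \<turnstile>(m,e,s) t \<Colon> \<tau>" "is_value v" "\<Gamma> k = {#}" "\<Gamma>' = ctx_drop 1 k \<Gamma>"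
  shows "subst_split t k v \<tau> \<Gamma>' m e s"
  by (rule subst_splitI[OF assms(1), of 0 0 1 0]) (use assms typing_value_nil in auto)

lemma subst_split_zero:
  assumes "0 \<turnstile>(m,e,s) t \<Colon> \<tau>" "is_value v"
  shows "subst_split t k v \<tau> 0 m e s"
  by (rule subst_split_trivial[OF assms]) (simp_all add: zero_fun_apply)

text \<open>The value is lifted when it enters the binder, so its derivation cannot contribute to
  index 0: the multitype of the bound variable comes from the body alone.\<close>

lemma subst_split_under_binder:
  assumes "subst_split t (Suc k) (lift 1 0 v) \<tau> \<Gamma>' m e s"
  obtains \<Gamma> \<Delta> m1 e1 s1 m2 e2 s2 where
    "\<Gamma> \<turnstile>(m1,e1,s1) t \<Colon> \<tau>" "\<Delta> \<turnstile>(m2,e2,s2) v \<Colon> MT (pop \<Gamma> k)" "\<Gamma>' 0 = \<Gamma> 0"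
    "pop \<Gamma>' = ctx_drop 1 k (pop \<Gamma>) + \<Delta>" "m = m1 + m2" "e = e1 + e2 - 1" "s = s1 + s2"
proof -
  obtain \<Gamma> \<Delta> m1 e1 s1 m2 e2 s2 where *:
    "\<Gamma> \<turnstile>(m1,e1,s1) t \<Colon> \<tau>" "\<Delta> \<turnstile>(m2,e2,s2) lift 1 0 v \<Colon> MT (\<Gamma> (Suc k))"
    "\<Gamma>' = ctx_drop 1 (Suc k) \<Gamma> + \<Delta>" "m = m1 + m2" "e = e1 + e2 - 1" "s = s1 + s2"
    using assms by (rule subst_splitE)
  have "vacuous 1 0 \<Delta>" "pop \<Delta> \<turnstile>(m2,e2,s2) v \<Colon> MT (\<Gamma> (Suc k))"
    using typing_unlift[OF *(2)] by (simp_all add: ctx_drop_1_0)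
  then show thesis
    by (intro that[OF *(1), of "pop \<Delta>" m2 e2 s2])
      (use * in \<open>simp_all add: pop_add pop_ctx_drop vacuous_def plus_fun_apply, simp add: pop_def\<close>)
qed

text \<open>The \<open>- 2\<close> is the unit saved by each of the two splittings that are merged.\<close>

lemma subst_split_merge:
  assumes "is_value v" "\<Delta>1 \<turnstile>(m1,e1,s1) v \<Colon> MT (\<Gamma>1 k)" "\<Delta>2 \<turnstile>(m2,e2,s2) v \<Colon> MT (\<Gamma>2 k)"
    and "\<Gamma>1 + \<Gamma>2 \<turnstile>(m3,e3,s3) t \<Colon> \<tau>"
    and "\<Gamma> = (ctx_drop 1 k \<Gamma>1 + \<Delta>1) + (ctx_drop 1 k \<Gamma>2 + \<Delta>2)"
    and "m = m1 + m2 + m3" "e = e1 + e2 + e3 - 2" "s = s1 + s2 + s3"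
  shows "subst_split t k v \<tau> \<Gamma> m e s"
  by (rule subst_splitI[OF assms(4), of "\<Delta>1 + \<Delta>2" "m1 + m2" "e1 + e2 - 1" "s1 + s2"])
    (use assms typing_value_merge[OF assms(1,2,3)] in
      \<open>simp_all add: ctx_drop_add plus_fun_apply add_ac\<close>)

text \<open>By induction on the term, whose shape \<open>subst t k v\<close> follows down to the
  variables. Each premise of the last rule gives a splitting, and the splittings are merged.\<close>

lemma anti_substitution:
  "\<Gamma> \<turnstile>(m,e,s) subst t k v \<Colon> \<tau> \<Longrightarrow> is_value v \<Longrightarrow> subst_split t k v \<tau> \<Gamma> m e s"
proof (induction t arbitrary: \<Gamma> m e s k v \<tau>)
  case (Var x)
  show ?case
  proof (cases "x = k")
    case True
    then have v: "\<Gamma> \<turnstile>(m,e,s) v \<Colon> \<tau>" using Var by simp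
    \<comment> \<open>The value keeps its derivation whole; the unit of the new \<open>var_c\<close>
      axiom is the one subtracted.\<close>
    have MT: ?thesis if "\<tau> = MT M" for M
    proof -
      have "\<Gamma> \<turnstile>(m,e,s) v \<Colon> MT (single_ctx k M k)"
        using v that by (simp add: single_ctx_apply)
      from subst_splitI[OF typing.var_c this] show ?thesis
        unfolding True that by (simp add: ctx_drop_single_same)
    qed
    \<comment> \<open>Every value has type \<open>vl\<close> by an axiom without demands, so the
      variable takes it from \<open>val_p\<close> and the value is left with the empty
      multitype.\<close>
    have TVl: ?thesis if "\<tau> = Tt TVl" "\<Gamma> = 0" "m = 0" "e = 0" "s = 0"
      unfolding that
      by (rule subst_split_zero[OF typing.val_p[unfolded empty_ctx_eq_0] Var.prems(2)])
    \<comment> \<open>Among values only variables have type \<open>vr\<close>. The replaced variable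
      takes over \<open>var_p\<close>, and \<open>y\<close> meets its demand through
      \<open>var_c\<close>.\<close>
    have TVr: ?thesis
      if "\<tau> = Tt TVr" "v = Var y" "\<Gamma> = single_ctx y {#Tt TVr#}" "m = 0" "e = 0" "s = 0" for y
    proof -
      have "single_ctx y {#Tt TVr#} \<turnstile>(0,1,0) v \<Colon> MT (single_ctx k {#Tt TVr#} k)"
        using typing.var_c by (simp add: single_ctx_apply that)
      from subst_splitI[OF typing.var_p this] show ?thesis
        unfolding True that by (simp add: ctx_drop_single_same)
    qed
    show ?thesis
    proof (cases v)
      case (Var y)
      show ?thesis using v unfolding Var
        by (rule typing_VarE) (use MT TVl TVr Var in \<open>auto simp: empty_ctx_eq_0\<close>)
    next
      case (Lam t')
      show ?thesis using v unfolding Lam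
        by (rule typing_LamE) (use MT TVl Lam in \<open>auto simp: empty_ctx_eq_0\<close>)
    qed (use Var in auto)
  next
    case False
    define y where "y = (if x < k then x else x - 1)"
    have y: "\<Gamma> \<turnstile>(m,e,s) Var y \<Colon> \<tau>"
      using Var.prems(1) False by (simp add: y_def split: if_splits)
    have single: ?thesis if "single_ctx x M \<turnstile>(m,e,s) Var x \<Colon> \<tau>" "\<Gamma> = single_ctx y M" for M
    proof (rule subst_split_trivial[OF that(1) Var.prems(2)])
      show "single_ctx x M k = {#}" using False by (simp add: single_ctx_apply)
      show "\<Gamma> = ctx_drop 1 k (single_ctx x M)"
        using that(2) False by (simp add: ctx_drop_single_neq y_def)
    qed
    show ?thesis
      using typing.var_p[of x] typing.var_c[of x] single
        subst_split_zero[OF typing.val_p[unfolded empty_ctx_eq_0] Var.prems(2)]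
      by - (rule typing_VarE[OF y], simp_all add: empty_ctx_eq_0)
  qed
next
  case (Lam t)
  from Lam.prems have "\<Gamma> \<turnstile>(m,e,s) Lam (subst t (Suc k) (lift 1 0 v)) \<Colon> \<tau>" by simp
  then show ?case
  proof (cases rule: typing_LamE)
    case 1
    then show ?thesis using subst_split_zero[OF typing.abs_p[unfolded empty_ctx_eq_0] Lam.prems(2)]
      by (simp add: empty_ctx_eq_0)
  next
    case (2 I \<Gamma>s ms es ss \<tau>s)
    then obtain M where \<tau>: "\<tau> = MT M" by blast
    from Lam.prems have "\<Gamma> \<turnstile>(m,e,s) Lam (subst t (Suc k) (lift 1 0 v)) \<Colon> MT M" by (simp add: \<tau>)
    then show ?thesis unfolding \<tau>
    proof (induction rule: typing_Lam_induct)
      case nil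
      show ?case by (rule subst_split_zero[OF typing_Lam_nil Lam.prems(2)])
    next
      case (add \<Gamma> m e s \<tau> \<Delta> m' e' s' M)
      have "is_value (lift 1 0 v)" using Lam.prems by (cases v) auto
      from Lam.IH[OF add(1) this] obtain \<Gamma>1 \<Delta>1 m1 e1 s1 m2 e2 s2 where 1:
        "\<Gamma>1 \<turnstile>(m1,e1,s1) t \<Colon> \<tau>" "\<Delta>1 \<turnstile>(m2,e2,s2) v \<Colon> MT (pop \<Gamma>1 k)" "\<Gamma> 0 = \<Gamma>1 0"
        "pop \<Gamma> = ctx_drop 1 k (pop \<Gamma>1) + \<Delta>1" "m = m1 + m2" "e = e1 + e2 - 1" "s = s1 + s2"
        by (rule subst_split_under_binder)
      from add(3) obtain \<Gamma>2 \<Delta>2 m3 e3 s3 m4 e4 s4 where 2: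
        "\<Gamma>2 \<turnstile>(m3,e3,s3) Lam t \<Colon> MT M" "\<Delta>2 \<turnstile>(m4,e4,s4) v \<Colon> MT (\<Gamma>2 k)"
        "\<Delta> = ctx_drop 1 k \<Gamma>2 + \<Delta>2" "m' = m3 + m4" "e' = e3 + e4 - 1" "s' = s3 + s4"
        by (rule subst_splitE)
      show ?case
        \<comment> \<open>The value adds nothing to the source of the arrow, so the same arrow is
          rebuilt over \<open>t\<close>.\<close>
        unfolding 1(3)
        by (rule subst_split_merge[OF Lam.prems(2) 1(2) 2(2) typing_Lam_add[OF 1(1) 2(1)]])
          (use 1 2 in simp_all)
    qed
  qed
next
  case (App t u)
  from App.prems have "\<Gamma> \<turnstile>(m,e,s) App (subst t k v) (subst u k v) \<Colon> \<tau>" by simp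
  then show ?case
  proof (cases rule: typing_App_cases)
    case (1 \<Gamma>1 m1 e1 s1 \<sigma>1 \<Gamma>2 m2 e2 s2 \<sigma>2 a b c)
    from App.IH(1)[OF 1(1) App.prems(2)] obtain \<Gamma>3 \<Delta>3 m3 e3 s3 m4 e4 s4 where 2:
      "\<Gamma>3 \<turnstile>(m3,e3,s3) t \<Colon> \<sigma>1" "\<Delta>3 \<turnstile>(m4,e4,s4) v \<Colon> MT (\<Gamma>3 k)"
      "\<Gamma>1 = ctx_drop 1 k \<Gamma>3 + \<Delta>3" "m1 = m3 + m4" "e1 = e3 + e4 - 1" "s1 = s3 + s4"
      by (rule subst_splitE)
    from App.IH(2)[OF 1(2) App.prems(2)] obtain \<Gamma>5 \<Delta>5 m5 e5 s5 m6 e6 s6 where 3: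
      "\<Gamma>5 \<turnstile>(m5,e5,s5) u \<Colon> \<sigma>2" "\<Delta>5 \<turnstile>(m6,e6,s6) v \<Colon> MT (\<Gamma>5 k)"
      "\<Gamma>2 = ctx_drop 1 k \<Gamma>5 + \<Delta>5" "m2 = m5 + m6" "e2 = e5 + e6 - 1" "s2 = s5 + s6"
      by (rule subst_splitE)
    show ?thesis
      by (rule subst_split_merge[OF App.prems(2) 2(2) 3(2) 1(7)[OF 2(1) 3(1)]])
        (use 1(3-6) 2 3 in simp_all)
  qed
next
  case (ES t u)
  from ES.prems have "\<Gamma> \<turnstile>(m,e,s) ES (subst t (Suc k) (lift 1 0 v)) (subst u k v) \<Colon> \<tau>" by simp
  then obtain \<Gamma>1 m1 e1 s1 \<Gamma>2 m2 e2 s2 \<sigma>2 where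
    t: "\<Gamma>1 \<turnstile>(m1,e1,s1) subst t (Suc k) (lift 1 0 v) \<Colon> \<tau>" and u: "\<Gamma>2 \<turnstile>(m2,e2,s2) subst u k v \<Colon> \<sigma>2"
    and arg: "arg_type (\<Gamma>1 0) \<sigma>2"
    and eq: "\<Gamma> = pop \<Gamma>1 + \<Gamma>2" "m = m1 + m2" "e = e1 + e2" "s = s1 + s2"
    by (rule typing_ES_cases)
  have "is_value (lift 1 0 v)" using ES.prems by (cases v) auto
  from ES.IH(1)[OF t this] obtain \<Gamma>3 \<Delta>3 m3 e3 s3 m4 e4 s4 where 1:
    "\<Gamma>3 \<turnstile>(m3,e3,s3) t \<Colon> \<tau>" "\<Delta>3 \<turnstile>(m4,e4,s4) v \<Colon> MT (pop \<Gamma>3 k)" "\<Gamma>1 0 = \<Gamma>3 0"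
    "pop \<Gamma>1 = ctx_drop 1 k (pop \<Gamma>3) + \<Delta>3" "m1 = m3 + m4" "e1 = e3 + e4 - 1" "s1 = s3 + s4"
    by (rule subst_split_under_binder)
  from ES.IH(2)[OF u ES.prems(2)] obtain \<Gamma>5 \<Delta>5 m5 e5 s5 m6 e6 s6 where 2:
    "\<Gamma>5 \<turnstile>(m5,e5,s5) u \<Colon> \<sigma>2" "\<Delta>5 \<turnstile>(m6,e6,s6) v \<Colon> MT (\<Gamma>5 k)"
    "\<Gamma>2 = ctx_drop 1 k \<Gamma>5 + \<Delta>5" "m2 = m5 + m6" "e2 = e5 + e6 - 1" "s2 = s5 + s6"
    by (rule subst_splitE)
  show ?case
    by (rule subst_split_merge[OF ES.prems(2) 1(2) 2(2) typing_ES[OF 1(1) 2(1) arg[unfolded 1(3)]]])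
      (use eq 1 2 in simp_all)
qed

section \<open>Subject expansion\<close>

text \<open>At the empty list context this is \<open>anti_substitution\<close>. Otherwise the
  outermost substitution of \<open>L\<close> moves from around the result to around the
  value.\<close>

lemma typing_sv_lplug:
  assumes "is_value v" and "\<Gamma> \<turnstile>(m,e,s) lplug L (subst (lift (lctx_depth L) 1 t) 0 v) \<Colon> \<tau>"
  shows "subst_split t 0 (lplug L v) \<tau> \<Gamma> m e s"
  using assms(2)
proof (induction L arbitrary: \<Gamma> m e s t)
  case LHole
  have "lift 0 c t = t" for c by (induction t arbitrary: c) auto
  then show ?case using LHole anti_substitution assms(1) by simp
next
  case (LES L u)
  \<comment> \<open>\<open>t\<close> is lifted past one binder of \<open>L\<close> at a time; the
    cutoff 1 spares the variable being substituted.\<close>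
  let ?t = "lift 1 1 t"
  have lift: "lift (lctx_depth (LES L u)) 1 t = lift (lctx_depth L) 1 ?t"
    by (simp add: lift_lift)
  have "\<Gamma> \<turnstile>(m,e,s) ES (lplug L (subst (lift (lctx_depth L) 1 ?t) 0 v)) u \<Colon> \<tau>"
    using LES.prems unfolding lift by simp
  then obtain \<Gamma>1 m1 e1 s1 \<Gamma>2 m2 e2 s2 \<sigma> where
    body: "\<Gamma>1 \<turnstile>(m1,e1,s1) lplug L (subst (lift (lctx_depth L) 1 ?t) 0 v) \<Colon> \<tau>"
    and u: "\<Gamma>2 \<turnstile>(m2,e2,s2) u \<Colon> \<sigma>" and arg: "arg_type (\<Gamma>1 0) \<sigma>"
    and eq: "\<Gamma> = pop \<Gamma>1 + \<Gamma>2" "m = m1 + m2" "e = e1 + e2" "s = s1 + s2"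
    by (rule typing_ES_cases)
  from LES.IH[OF body] obtain \<Gamma>3 \<Delta> m3 e3 s3 m4 e4 s4 where 1:
    "\<Gamma>3 \<turnstile>(m3,e3,s3) ?t \<Colon> \<tau>" "\<Delta> \<turnstile>(m4,e4,s4) lplug L v \<Colon> MT (\<Gamma>3 0)"
    "\<Gamma>1 = ctx_drop 1 0 \<Gamma>3 + \<Delta>" "m1 = m3 + m4" "e1 = e3 + e4 - 1" "s1 = s3 + s4"
    by (rule subst_splitE)
  have t: "vacuous 1 1 \<Gamma>3" "ctx_drop 1 1 \<Gamma>3 \<turnstile>(m3,e3,s3) t \<Colon> \<tau>"
    using typing_unlift[OF 1(1)] by simp_all
  \<comment> \<open>Index 1 of \<open>\<Gamma>3\<close> is the variable that \<open>u\<close> is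
    substituted for. The lifted body does not use it, so all demand on \<open>u\<close> comes from
    the value side.\<close>
  have "\<Delta> 0 = \<Gamma>1 0"
    using t(1) 1(3) by (simp add: ctx_drop_def vacuous_def plus_fun_apply)
  with typing_ES[OF 1(2) u] arg have "pop \<Delta> + \<Gamma>2 \<turnstile>(m4 + m2, e4 + e2, s4 + s2) lplug (LES L u) v
    \<Colon> MT (ctx_drop 1 1 \<Gamma>3 0)"
    by simp
  then show ?case
    by (rule subst_splitI[OF t(2)])
      (use eq 1 in \<open>simp_all add: ctx_drop_1_0 pop_add pop_ctx_drop add.assoc\<close>)
qed

lemma typing_expand_sv:
  assumes "sv t u" and "\<Gamma> \<turnstile>(m,e,s) u \<Colon> \<tau>"
  shows "\<Gamma> \<turnstile>(m,e + 1,s) t \<Colon> \<tau>"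
  using assms(1)
proof cases
  case (1 v t' L)
  obtain \<Gamma>1 \<Delta> m1 e1 s1 m2 e2 s2 where *:
    "\<Gamma>1 \<turnstile>(m1,e1,s1) t' \<Colon> \<tau>" "\<Delta> \<turnstile>(m2,e2,s2) lplug L v \<Colon> MT (\<Gamma>1 0)"
    "\<Gamma> = ctx_drop 1 0 \<Gamma>1 + \<Delta>" "m = m1 + m2" "e = e1 + e2 - 1" "s = s1 + s2"
    using typing_sv_lplug[OF 1(3) assms(2)[unfolded 1(2)]] by (rule subst_splitE)
  from typing.es_c[OF *(1,2)] show ?thesis
    unfolding 1(1) by (rule typing_cong) (use * in \<open>simp_all add: ctx_drop_1_0\<close>)
qed

text \<open>The argument leaves the scope of \<open>L\<close>, whose substitutions stay around the
  abstraction. The abstraction gets a family with one member, and the unit of its root gives the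
  \<open>- 1\<close>, which \<open>typing_App\<close> absorbs.\<close>

lemma typing_dB_lplug:
  assumes "\<Gamma> \<turnstile>(m,e,s) lplug L (ES t (lift (lctx_depth L) 0 u)) \<Colon> \<tau>"
  obtains \<Gamma>1 m1 e1 s1 M \<Gamma>2 m2 e2 s2 \<sigma> where
    "\<Gamma>1 \<turnstile>(m1,e1,s1) lplug L (Lam t) \<Colon> MT {#Arr M \<tau>#}" "\<Gamma>2 \<turnstile>(m2,e2,s2) u \<Colon> \<sigma>" "arg_type M \<sigma>"
    "\<Gamma> = \<Gamma>1 + \<Gamma>2" "m = m1 + m2" "e = e1 + e2 - 1" "s = s1 + s2"
  using assms
proof (induction L arbitrary: \<Gamma> m e s u thesis)
  case LHole
  have "lift 0 c u = u" for c by (induction u arbitrary: c) auto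
  with LHole.prems(2) have "\<Gamma> \<turnstile>(m,e,s) ES t u \<Colon> \<tau>" by simp
  then obtain \<Gamma>1 m1 e1 s1 \<Gamma>2 m2 e2 s2 \<sigma> where *:
    "\<Gamma>1 \<turnstile>(m1,e1,s1) t \<Colon> \<tau>" "\<Gamma>2 \<turnstile>(m2,e2,s2) u \<Colon> \<sigma>" "arg_type (\<Gamma>1 0) \<sigma>"
    "\<Gamma> = pop \<Gamma>1 + \<Gamma>2" "m = m1 + m2" "e = e1 + e2" "s = s1 + s2"
    by (rule typing_ES_cases)
  have "pop \<Gamma>1 \<turnstile>(m1,e1 + 1,s1) lplug LHole (Lam t) \<Colon> MT {#Arr (\<Gamma>1 0) \<tau>#}"
    using typing_Lam_add[OF *(1) typing_Lam_nil] by simp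
  from LHole.prems(1)[OF this *(2,3,4)] * show ?case by simp
next
  case (LES L r)
  let ?u = "lift 1 0 u"
  have lift: "lift (lctx_depth (LES L r)) 0 u = lift (lctx_depth L) 0 ?u"
    by (simp add: lift_lift)
  have "\<Gamma> \<turnstile>(m,e,s) ES (lplug L (ES t (lift (lctx_depth L) 0 ?u))) r \<Colon> \<tau>"
    using LES.prems(2) unfolding lift by simp
  then obtain \<Gamma>1 m1 e1 s1 \<Gamma>2 m2 e2 s2 \<sigma>' where
    body: "\<Gamma>1 \<turnstile>(m1,e1,s1) lplug L (ES t (lift (lctx_depth L) 0 ?u)) \<Colon> \<tau>"
    and r: "\<Gamma>2 \<turnstile>(m2,e2,s2) r \<Colon> \<sigma>'" and arg: "arg_type (\<Gamma>1 0) \<sigma>'"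
    and eq: "\<Gamma> = pop \<Gamma>1 + \<Gamma>2" "m = m1 + m2" "e = e1 + e2" "s = s1 + s2"
    by (rule typing_ES_cases)
  obtain \<Gamma>3 m3 e3 s3 M \<Gamma>4 m4 e4 s4 \<sigma> where 1:
    "\<Gamma>3 \<turnstile>(m3,e3,s3) lplug L (Lam t) \<Colon> MT {#Arr M \<tau>#}" "\<Gamma>4 \<turnstile>(m4,e4,s4) ?u \<Colon> \<sigma>" "arg_type M \<sigma>"
    "\<Gamma>1 = \<Gamma>3 + \<Gamma>4" "m1 = m3 + m4" "e1 = e3 + e4 - 1" "s1 = s3 + s4"
    by (rule LES.IH[OF _ body])
  have u: "vacuous 1 0 \<Gamma>4" "pop \<Gamma>4 \<turnstile>(m4,e4,s4) u \<Colon> \<sigma>"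
    using typing_unlift[OF 1(2)] by (simp_all add: ctx_drop_1_0)
  \<comment> \<open>The lifted argument does not use the variable that \<open>r\<close> is
    substituted for, so \<open>r\<close> still fits once the argument is gone.\<close>
  have "\<Gamma>3 0 = \<Gamma>1 0" using u(1) 1(4) by (simp add: vacuous_def plus_fun_apply)
  with typing_ES[OF 1(1) r] arg
  have "pop \<Gamma>3 + \<Gamma>2 \<turnstile>(m3 + m2, e3 + e2, s3 + s2) lplug (LES L r) (Lam t) \<Colon> MT {#Arr M \<tau>#}"
    by simp
  from LES.prems(1)[OF this u(2) 1(3)] eq 1(4-7) show ?case
    by (simp add: pop_add add_ac)
qed

lemma typing_expand_dB:
  assumes "dB t u" and "\<Gamma> \<turnstile>(m,e,s) u \<Colon> \<tau>"
  shows "\<Gamma> \<turnstile>(m + 1,e,s) t \<Colon> \<tau>"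
  using assms(1)
proof cases
  case (1 L t' u')
  obtain \<Gamma>1 m1 e1 s1 M \<Gamma>2 m2 e2 s2 \<sigma> where *:
    "\<Gamma>1 \<turnstile>(m1,e1,s1) lplug L (Lam t') \<Colon> MT {#Arr M \<tau>#}" "\<Gamma>2 \<turnstile>(m2,e2,s2) u' \<Colon> \<sigma>" "arg_type M \<sigma>"
    "\<Gamma> = \<Gamma>1 + \<Gamma>2" "m = m1 + m2" "e = e1 + e2 - 1" "s = s1 + s2"
    by (rule typing_dB_lplug[OF assms(2)[unfolded 1(2)]])
  from typing_App[OF *(1-3)] show ?thesis
    unfolding 1(1) by (rule typing_cong) (use * in simp_all)
qed

section \<open>Closure under CBV contexts and along reduction sequences\<close>

text \<open>The hole is never under an abstraction, where \<open>abs_c\<close> could type it any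
  number of times. It is typed once, expansion keeps its context and type, and the last rule is
  replayed with the increments \<open>a\<close> and \<open>b\<close> passed through.\<close>

lemma typing_expand_vplug:
  assumes expand: "\<And>\<Gamma> m e s \<tau>. \<Gamma> \<turnstile>(m,e,s) u \<Colon> \<tau> \<Longrightarrow> \<Gamma> \<turnstile>(m + a,e + b,s) t \<Colon> \<tau>"
    and "\<Gamma> \<turnstile>(m,e,s) vplug V u \<Colon> \<tau>"
  shows "\<Gamma> \<turnstile>(m + a,e + b,s) vplug V t \<Colon> \<tau>"
  using assms(2)
proof (induction V arbitrary: \<Gamma> m e s \<tau>)
  case VHole
  then show ?case using expand by simp
next
  case (VAppL V r)
  from VAppL.prems have "\<Gamma> \<turnstile>(m,e,s) App (vplug V u) r \<Colon> \<tau>" by simp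
  then show ?case
  proof (cases rule: typing_App_cases)
    case (1 \<Gamma>1 m1 e1 s1 \<sigma>1 \<Gamma>2 m2 e2 s2 \<sigma>2 a' b' c')
    from 1(7)[OF VAppL.IH[OF 1(1)] 1(2)] show ?thesis
      unfolding vplug.simps by (rule typing_cong) (use 1 in simp_all)
  qed
next
  case (VAppR r V)
  from VAppR.prems have "\<Gamma> \<turnstile>(m,e,s) App r (vplug V u) \<Colon> \<tau>" by simp
  then show ?case
  proof (cases rule: typing_App_cases)
    case (1 \<Gamma>1 m1 e1 s1 \<sigma>1 \<Gamma>2 m2 e2 s2 \<sigma>2 a' b' c')
    from 1(7)[OF 1(1) VAppR.IH[OF 1(2)]] show ?thesis
      unfolding vplug.simps by (rule typing_cong) (use 1 in simp_all)
  qed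
next
  case (VESL V r)
  from VESL.prems have "\<Gamma> \<turnstile>(m,e,s) ES (vplug V u) r \<Colon> \<tau>" by simp
  then show ?case
  proof (cases rule: typing_ES_cases)
    case (1 \<Gamma>1 m1 e1 s1 \<Gamma>2 m2 e2 s2 \<sigma>)
    from typing_ES[OF VESL.IH[OF 1(1)] 1(2,3)] show ?thesis
      unfolding vplug.simps by (rule typing_cong) (use 1 in simp_all)
  qed
next
  case (VESR r V)
  from VESR.prems have "\<Gamma> \<turnstile>(m,e,s) ES r (vplug V u) \<Colon> \<tau>" by simp
  then show ?case
  proof (cases rule: typing_ES_cases)
    case (1 \<Gamma>1 m1 e1 s1 \<Gamma>2 m2 e2 s2 \<sigma>)
    from typing_ES[OF 1(1) VESR.IH[OF 1(2)] 1(3)] show ?thesis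
      unfolding vplug.simps by (rule typing_cong) (use 1 in simp_all)
  qed
qed

lemma typing_expand_m_step:
  assumes "m_step t u" and "\<Gamma> \<turnstile>(m,e,s) u \<Colon> \<tau>"
  shows "\<Gamma> \<turnstile>(m + 1,e,s) t \<Colon> \<tau>"
  using assms(1)
proof cases
  case (1 t' u' V)
  then show ?thesis
    using typing_expand_vplug[of u' 1 0 t'] typing_expand_dB assms(2) by simp
qed

lemma typing_expand_e_step:
  assumes "e_step t u" and "\<Gamma> \<turnstile>(m,e,s) u \<Colon> \<tau>"
  shows "\<Gamma> \<turnstile>(m,e + 1,s) t \<Colon> \<tau>"
  using assms(1)
proof cases
  case (1 t' u' V)
  then show ?thesis
    using typing_expand_vplug[of u' 0 1 t'] typing_expand_sv assms(2) by simp
qed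

text \<open>Starting from zero step counters at \<open>p\<close> makes the final ones equal to the
  numbers of steps.\<close>

lemma typing_expand_reds:
  "reds t m e p \<Longrightarrow> \<Gamma> \<turnstile>(0,0,s) p \<Colon> \<tau> \<Longrightarrow> \<Gamma> \<turnstile>(int m,int e,s) t \<Colon> \<tau>"
proof (induction rule: reds.induct)
  case (reds_m t u m e p)
  from typing_expand_m_step[OF reds_m(1) reds_m.IH[OF reds_m.prems]] show ?case
    by (simp add: add.commute)
next
  case (reds_e t u m e p)
  from typing_expand_e_step[OF reds_e(1) reds_e.IH[OF reds_e.prems]] show ?case
    by (simp add: add.commute)
qed simp

section \<open>Normal forms\<close>

lemma tight_ctx_add: "tight_ctx \<Gamma> \<Longrightarrow> tight_ctx \<Delta> \<Longrightarrow> tight_ctx (\<Gamma> + \<Delta>)"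
  by (auto simp: tight_ctx_def tight_mty_def plus_fun_apply)

lemma tight_ctx_pop: "tight_ctx \<Gamma> \<Longrightarrow> tight_ctx (pop \<Gamma>)"
  by (simp add: tight_ctx_def pop_def)

definition tightly_typed :: "trm \<Rightarrow> tt \<Rightarrow> bool" where
  "tightly_typed t a \<longleftrightarrow> (\<exists>\<Gamma>. tight_ctx \<Gamma> \<and> \<Gamma> \<turnstile>(0,0,int (v_size t)) t \<Colon> Tt a)"

lemma tightly_typedI:
  "\<Gamma> \<turnstile>(0,0,s) t \<Colon> Tt a \<Longrightarrow> tight_ctx \<Gamma> \<Longrightarrow> s = int (v_size t) \<Longrightarrow> tightly_typed t a"
  unfolding tightly_typed_def by blast

lemma tight_ctx_empty: "tight_ctx empty_ctx"
  by (simp add: tight_ctx_def tight_mty_def empty_ctx_def)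

lemma tightly_typed_Var_TVr: "tightly_typed (Var x) TVr"
  by (rule tightly_typedI[OF typing.var_p])
    (simp_all add: tight_ctx_def tight_mty_def tight_ty_def single_ctx_apply)

lemma tightly_typed_Var_TVl: "tightly_typed (Var x) TVl"
  by (rule tightly_typedI[OF typing.val_p tight_ctx_empty]) simp

lemma tightly_typed_Lam: "tightly_typed (Lam t) TVl"
  by (rule tightly_typedI[OF typing.abs_p tight_ctx_empty]) simp

lemma tightly_typed_App:
  assumes "tightly_typed t a" "a \<in> {TVr, TN}" "tightly_typed u b" "b \<in> {TVl, TN}"
  shows "tightly_typed (App t u) TN"
proof -
  obtain \<Gamma> \<Delta> where *: "tight_ctx \<Gamma>" "tight_ctx \<Delta>"
    "\<Gamma> \<turnstile>(0,0,int (v_size t)) t \<Colon> Tt a" "\<Delta> \<turnstile>(0,0,int (v_size u)) u \<Colon> Tt b"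
    using assms(1,3) unfolding tightly_typed_def by blast
  from typing.app_p[OF *(3) assms(2) *(4) assms(4)] show ?thesis
    unfolding add_0 by (rule tightly_typedI) (simp_all add: tight_ctx_add *(1,2))
qed

text \<open>\<open>es_p\<close> keeps the type of the body, so this serves all three classes of
  normal forms.\<close>

lemma tightly_typed_ES:
  assumes "tightly_typed t a" "tightly_typed u TN"
  shows "tightly_typed (ES t u) a"
proof -
  obtain \<Gamma> \<Delta> where *: "tight_ctx \<Gamma>" "tight_ctx \<Delta>"
    "\<Gamma> \<turnstile>(0,0,int (v_size t)) t \<Colon> Tt a" "\<Delta> \<turnstile>(0,0,int (v_size u)) u \<Colon> Tt TN"
    using assms unfolding tightly_typed_def by blast
  have "tight_mty (\<Gamma> 0)" using *(1) by (simp add: tight_ctx_def)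
  from typing.es_p[OF *(3,4) this] show ?thesis
    unfolding add_0 by (rule tightly_typedI) (simp_all add: tight_ctx_add tight_ctx_pop *(1,2))
qed

text \<open>Terms of \<open>vr_v\<close> need both types: \<open>app_p\<close> asks for
  \<open>vr\<close> or \<open>n\<close> at the head and for \<open>vl\<close> or \<open>n\<close> in
  the argument, and such terms occur in both places.\<close>

lemma normal_tightly_typed:
  shows "vr_v t \<Longrightarrow> tightly_typed t TVr \<and> tightly_typed t TVl"
    and "ne_v t \<Longrightarrow> tightly_typed t TN"
    and "no_v t \<Longrightarrow> \<exists>a \<in> {TVl, TN}. tightly_typed t a"
  by (induction rule: vr_v_ne_v_no_v.inducts)
    (blast intro: tightly_typed_Var_TVr tightly_typed_Var_TVl tightly_typed_Lam tightly_typed_App tightly_typed_ES)+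

theorem theorem4p13:
  fixes t p :: trm and m e :: nat
  assumes "reds t m e p" and "no_v p"
  shows "\<exists>\<Gamma> \<sigma>. fin_ctx \<Gamma> \<and> \<Gamma> \<turnstile>(int m, int e, int (v_size p)) t \<Colon> \<sigma> \<and>
    tight_ctx \<Gamma> \<and> tight_ty \<sigma>"
proof -
  obtain \<Gamma> a where "tight_ctx \<Gamma>" "\<Gamma> \<turnstile>(0,0,int (v_size p)) p \<Colon> Tt a"
    using normal_tightly_typed(3)[OF assms(2)] unfolding tightly_typed_def by blast
  \<comment> \<open>Expansion changes neither context nor type, so tightness carries over from
    \<open>p\<close> to \<open>t\<close>.\<close>
  with typing_expand_reds[OF assms(1)] typing_fin_ctx show ?thesis
    unfolding tight_ty_def by blast
qed

end
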